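(* Let $K\subseteq\mathbb{R}^n$ be an open convex set, let $f:K\to\mathbb{R}$, $g=(g_1,\dots,g_m):K\to\mathbb{R}^m$ and $h=(h_1,\dots,h_k):K\to\mathbb{R}^k$, and let $$C':=\{x\in K:\ g_i(x)\le 0\ (i=1,\dots,m),\ h_j(x)=0\ (j=1,\dots,k)\}.$$ Let $e=(e_1,\dots,e_m)$, where each $e_i:\mathbb{R}^n\times\mathbb{R}^n\to\mathbb{R}$ is an error bifunction. Let $\overline{x}\in C'$ and suppose that $f$, $g$ and $h$ have a directional derivative at $\overline{x}$ in every direction $x-\overline{x}$ with $x\in K$, and that all the functions $f,g_i,h_j$ are Gâteaux differentiable on $K$. Assume that there exists $(\overline{u},\overline{v})\in\mathbb{R}^m_+\times\mathbb{R}^k$, $(\overline{u},\overline{v})\ne(0,0)$, with $$\Big\langle f'(\overline{x})+\sum_{i=1}^m\overline{u}_i g_i'(\overline{x})+\sum_{j=1}^k\overline{v}_j h_j'(\overline{x}),\ x-\overline{x}\Big\rangle\ \ge\ \sum_{i=1}^m\overline{u}_i e_i(x,\overline{x})\quad\text{for all } x\in K,$$ $$\sum_{i=1}^m\overline{u}_i g_i(\overline{x})=0 .$$ Let $\mathcal{L}(g(\overline{x}))$ denote the linear subspace of $\mathbb{R}^m$ spanned by $g(\overline{x})$. Then $\overline{x}$ is a global minimum of $f$ on $$\widetilde{C}:=\{x\in K:\ g(x)\in-\mathbb{R}^m_++\mathcal{L}(g(\overline{x})),\ h(x)=0_k\}$$ if and only if the map $(f,g,h):K\to\mathbb{R}\times\mathbb{R}^m\times\mathbb{R}^k$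 is $\widehat{C}$-$\widehat{e}$-quasiconvex at $\overline{x}$, where $\widehat{e}:=(0,e,0_k)$ and $$\widehat{C}:=(\mathbb{R}_-\setminus\{0\})\times\big(-\mathbb{R}^m_++\mathcal{L}(g(\overline{x}))\big)\times\{0_k\}.$$
   Context: An error bifunction is a map $e:\mathbb{R}^n\times\mathbb{R}^n\to\mathbb{R}\cup\{+\infty\}$ that is nonnegative, symmetric ($e(x,y)=e(y,x)$) and finite at some point; here all error bifunctions are real-valued. $\mathbb{R}_-=\,]-\infty,0]$, $\mathbb{R}_+=[0,+\infty[$, and $0_k$ is the zero vector of $\mathbb{R}^k$. For $\varphi:S\subseteq\mathbb{R}^p\to\mathbb{R}^q$, $\overline{x}\in S$ and $w\in\mathbb{R}^p$, the directional derivative is $\varphi'(\overline{x})(w)=\lim_{t\to0^+}\frac{\varphi(\overline{x}+tw)-\varphi(\overline{x})}{t}$ (when the limit exists). For a Gâteaux differentiable real-valued function, $f'(\overline{x})$ also denotes the Gâteaux derivative, with $\langle f'(\overline{x}),w\rangle=f'(\overline{x})(w)$. Definition ($\widehat{C}$-$e$-quasiconvexity of a vector map). Let $S\subseteq\mathbb{R}^n$ and $\widehat{C}\subseteq\mathbb{R}^M$ be nonempty, let $e=(e_1,\dots,e_M)$ with each $e_i:\mathbb{R}^n\times\mathbb{R}^n\to\mathbb{R}$ an error bifunction, and let $\varphi:S\to\mathbb{R}^M$ have a directional derivative at $\overline{x}\in S$ in every direction $x-\overline{x}$ with $x\in S$. Then $\varphi$ is $\widehat{C}$-$e$-quasiconvex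 at $\overline{x}$ if for all $x\in S$, $$\varphi(x)-\varphi(\overline{x})\in\widehat{C}\ \Longrightarrow\ \varphi'(\overline{x})(x-\overline{x})-e(x,\overline{x})\in\widehat{C}.$$ In the theorem this is applied with $S=K$, $M=1+m+k$, $\varphi=(f,g,h)$ and error vector $\widehat{e}=(0,e_1,\dots,e_m,0,\dots,0)$. *)

theory Defs
  imports "HOL-Analysis.Analysis"
begin

text \<open>Nonnegative symmetric real-valued bifunctions; finiteness at some point is automatic
  because the values are real.\<close>

definition error_bifunction :: "('a \<Rightarrow> 'a \<Rightarrow> real) \<Rightarrow> bool" where
  "error_bifunction e \<longleftrightarrow> (\<forall>x y. 0 \<le> e x y) \<and> (\<forall>x y. e x y = e y x)"

text \<open>A map \<open>\<phi> : S \<rightarrow> \<real>\<^sup>q\<close> is a total function together with its domain \<open>S\<close>. The first conjunct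
  says that the difference quotient is defined for all small \<open>t > 0\<close>, so that only the values
  of \<open>\<phi>\<close> on \<open>S\<close> matter.\<close>

definition has_dir_deriv ::
  "'a::real_normed_vector set \<Rightarrow> ('a \<Rightarrow> 'b::real_normed_vector) \<Rightarrow> 'a \<Rightarrow> 'a \<Rightarrow> 'b \<Rightarrow> bool" where
  "has_dir_deriv S \<phi> x w d \<longleftrightarrow>
     x \<in> S \<and> (\<forall>\<^sub>F t in at_right (0::real). x + t *\<^sub>R w \<in> S) \<and>
     ((\<lambda>t. (\<phi> (x + t *\<^sub>R w) - \<phi> x) /\<^sub>R t) \<longlongrightarrow> d) (at_right 0)"

definition dir_deriv ::
  "'a::real_normed_vector set \<Rightarrow> ('a \<Rightarrow> 'b::real_normed_vector) \<Rightarrow> 'a \<Rightarrow> 'a \<Rightarrow> 'b" where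
  "dir_deriv S \<phi> x w = (THE d. has_dir_deriv S \<phi> x w d)"

text \<open>The one-sided limit suffices here: linearity of \<open>D\<close> turns the limits for \<open>w\<close> and \<open>-w\<close>
  into the two-sided one.\<close>

definition has_gateaux_deriv ::
  "'a::real_normed_vector set \<Rightarrow> ('a \<Rightarrow> 'b::real_normed_vector) \<Rightarrow> 'a \<Rightarrow> ('a \<Rightarrow>\<^sub>L 'b) \<Rightarrow> bool" where
  "has_gateaux_deriv S \<phi> x D \<longleftrightarrow> (\<forall>w. has_dir_deriv S \<phi> x w (blinfun_apply D w))"

definition gateaux_differentiable_on ::
  "('a::real_normed_vector \<Rightarrow> 'b::real_normed_vector) \<Rightarrow> 'a set \<Rightarrow> bool" where
  "gateaux_differentiable_on \<phi> S \<longleftrightarrow> (\<forall>x\<in>S. \<exists>D. has_gateaux_deriv S \<phi> x D)"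

definition gateaux_deriv ::
  "'a::real_normed_vector set \<Rightarrow> ('a \<Rightarrow> 'b::real_normed_vector) \<Rightarrow> 'a \<Rightarrow> ('a \<Rightarrow>\<^sub>L 'b)" where
  "gateaux_deriv S \<phi> x = (THE D. has_gateaux_deriv S \<phi> x D)"

text \<open>The codomain is any Euclidean space \<open>'b\<close>, standing for \<open>\<real>\<^sup>M\<close> with \<open>M = DIM('b)\<close>, so that
  products such as \<open>\<real> \<times> \<real>\<^sup>m \<times> \<real>\<^sup>k\<close> are covered; the components of the error vector \<open>e\<close> are its
  coordinates with respect to the standard basis. The conjuncts before the final implication
  are the standing assumptions under which the notion is defined.\<close>

definition e_quasiconvex_at ::
  "'a::euclidean_space set \<Rightarrow> 'b::euclidean_space set \<Rightarrow> ('a \<Rightarrow> 'a \<Rightarrow> 'b) \<Rightarrow> ('a \<Rightarrow> 'b) \<Rightarrow> 'a \<Rightarrow> bool"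
  where
  "e_quasiconvex_at S C e \<phi> xbar \<longleftrightarrow>
     C \<noteq> {} \<and> xbar \<in> S \<and>
     (\<forall>b\<in>Basis. error_bifunction (\<lambda>x y. e x y \<bullet> b)) \<and>
     (\<forall>x\<in>S. \<exists>d. has_dir_deriv S \<phi> xbar (x - xbar) d) \<and>
     (\<forall>x\<in>S. \<phi> x - \<phi> xbar \<in> C \<longrightarrow> dir_deriv S \<phi> xbar (x - xbar) - e x xbar \<in> C)"

text \<open>\<open>-\<real>\<^sup>m\<^sub>+\<close>, defined directly since unary minus on sets is the complement.\<close>

definition nonpos_orthant :: "(real ^ 'm) set" where
  "nonpos_orthant = {p. \<forall>i. p $ i \<le> 0}"

end

theory Submission
  imports Defs
begin

text \<open>If \<open>x\<close> is feasible for the enlarged problem and \<open>f x < f xbar\<close>, quasiconvexity puts the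
  derivative of \<open>(f, g, h)\<close> minus the error into the cone. Pairing it with \<open>(1, u, v)\<close> gives a negative
  number, because \<open>u\<close> is nonnegative and orthogonal to \<open>g xbar\<close>; this contradicts the multiplier
  inequality. Conversely, at a global minimum the premise of quasiconvexity is never
  satisfied, since the cone absorbs \<open>g xbar\<close>.\<close>

lemma has_dir_deriv_unique:
  assumes "has_dir_deriv S \<phi> x w d" "has_dir_deriv S \<phi> x w d'"
  shows "d = d'"
  using assms tendsto_unique[OF trivial_limit_at_right_real]
  unfolding has_dir_deriv_def by blast

lemma dir_deriv_eqI:
  assumes "has_dir_deriv S \<phi> x w d"
  shows "dir_deriv S \<phi> x w = d"
  unfolding dir_deriv_def using assms has_dir_deriv_unique by blast

lemma has_dir_deriv_Pair:
  assumes "has_dir_deriv S \<phi> x w d" "has_dir_deriv S \<psi> x w d'"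
  shows "has_dir_deriv S (\<lambda>y. (\<phi> y, \<psi> y)) x w (d, d')"
  using assms unfolding has_dir_deriv_def by (auto intro!: tendsto_Pair)

text \<open>Limits in \<open>real ^ 'm\<close> can be taken coordinatewise. This links the
  directional derivatives of \<open>g\<close> and \<open>h\<close> as vector maps to the Gateaux
  derivatives of their components, in which the multiplier inequality is stated.\<close>

lemma has_dir_deriv_nth:
  assumes "has_dir_deriv S \<phi> x w d"
  shows "has_dir_deriv S (\<lambda>y. \<phi> y $ i) x w (d $ i)"
proof -
  have "((\<lambda>t. ((\<phi> (x + t *\<^sub>R w) - \<phi> x) /\<^sub>R t) $ i) \<longlongrightarrow> d $ i) (at_right 0)"
    using assms by (intro tendsto_vec_nth) (simp add: has_dir_deriv_def)
  then show ?thesis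
    using assms by (simp add: has_dir_deriv_def)
qed

lemma has_gateaux_deriv_unique:
  assumes "has_gateaux_deriv S \<phi> x D" "has_gateaux_deriv S \<phi> x D'"
  shows "D = D'"
  using assms unfolding has_gateaux_deriv_def
  by (blast intro: blinfun_eqI has_dir_deriv_unique)

lemma gateaux_differentiable_on_imp_has_dir_deriv:
  assumes "gateaux_differentiable_on \<phi> S" "x \<in> S"
  shows "has_dir_deriv S \<phi> x w (blinfun_apply (gateaux_deriv S \<phi> x) w)"
proof -
  obtain D where D: "has_gateaux_deriv S \<phi> x D"
    using assms unfolding gateaux_differentiable_on_def by blast
  then have "gateaux_deriv S \<phi> x = D"
    unfolding gateaux_deriv_def using has_gateaux_deriv_unique by blast
  with D show ?thesis
    by (simp add: has_gateaux_deriv_def)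
qed

text \<open>The span absorbs both \<open>a\<close> and \<open>- a\<close>, so translating by either
  one keeps a point in \<open>A + span {a}\<close>.\<close>

lemma add_mem_plus_span_singleton_iff:
  fixes a y :: "'a::real_vector"
  shows "y + a \<in> A + span {a} \<longleftrightarrow> y \<in> A + span {a}"
proof -
  have shift: "z + b \<in> A + span {a}" if "z \<in> A + span {a}" "b \<in> span {a}" for z b
  proof -
    from that(1) obtain p s where "p \<in> A" "s \<in> span {a}" "z = p + s"
      by (rule set_plus_elim)
    with that(2) show ?thesis
      using set_plus_intro[of p A "s + b" "span {a}"] by (simp add: span_add add.assoc)
  qed
  have "a \<in> span {a}" "- a \<in> span {a}"
    by (simp_all add: span_base span_neg)
  with shift[of y a] shift[of "y + a" "- a"] show ?thesis
    by auto
qed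

text \<open>Orthogonality to \<open>a\<close> removes the span component, and what is left pairs a
  nonnegative vector with a nonpositive one.\<close>

lemma inner_nonpos_orthant_plus_span_le_zero:
  fixes u a :: "real ^ 'm"
  assumes "\<And>i. 0 \<le> u $ i" "u \<bullet> a = 0" "p \<in> nonpos_orthant + span {a}"
  shows "u \<bullet> p \<le> 0"
proof -
  obtain q c where q: "q \<in> nonpos_orthant" and p: "p = q + c *\<^sub>R a"
    using assms(3) by (auto elim!: set_plus_elim simp: span_singleton)
  have "u \<bullet> p = u \<bullet> q"
    by (simp add: p inner_add_right assms(2))
  also have "\<dots> \<le> 0"
    using q assms(1)
    by (auto simp: inner_vec_def nonpos_orthant_def intro!: sum_nonpos mult_nonneg_nonpos)
  finally show ?thesis .
qed

lemma error_bifunction_zero: "error_bifunction (\<lambda>x y. 0)"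
  by (simp add: error_bifunction_def)

theorem theorem17:
  fixes K :: "(real ^ 'n) set"
    and f :: "real ^ 'n \<Rightarrow> real"
    and g :: "real ^ 'n \<Rightarrow> real ^ 'm"
    and h :: "real ^ 'n \<Rightarrow> real ^ 'k"
    and e :: "'m \<Rightarrow> real ^ 'n \<Rightarrow> real ^ 'n \<Rightarrow> real"
    and xbar :: "real ^ 'n"
  assumes "open K" and "convex K"
    and "\<And>i. error_bifunction (e i)"
    and "xbar \<in> {x \<in> K. (\<forall>i. g x $ i \<le> 0) \<and> (\<forall>j. h x $ j = 0)}"
    and "\<And>x. x \<in> K \<Longrightarrow> \<exists>d. has_dir_deriv K f xbar (x - xbar) d"
    and "\<And>x. x \<in> K \<Longrightarrow> \<exists>d. has_dir_deriv K g xbar (x - xbar) d"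
    and "\<And>x. x \<in> K \<Longrightarrow> \<exists>d. has_dir_deriv K h xbar (x - xbar) d"
    and "gateaux_differentiable_on f K"
    and "\<And>i. gateaux_differentiable_on (\<lambda>x. g x $ i) K"
    and "\<And>j. gateaux_differentiable_on (\<lambda>x. h x $ j) K"
    and "\<exists>(u :: real ^ 'm) (v :: real ^ 'k).
           (\<forall>i. 0 \<le> u $ i) \<and> (u, v) \<noteq> (0, 0) \<and>
           (\<forall>x\<in>K. blinfun_apply
                     (gateaux_deriv K f xbar
                      + (\<Sum>i\<in>UNIV. u $ i *\<^sub>R gateaux_deriv K (\<lambda>x. g x $ i) xbar)
                      + (\<Sum>j\<in>UNIV. v $ j *\<^sub>R gateaux_deriv K (\<lambda>x. h x $ j) xbar))
                     (x - xbar)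
                   \<ge> (\<Sum>i\<in>UNIV. u $ i * e i x xbar)) \<and>
           (\<Sum>i\<in>UNIV. u $ i * g xbar $ i) = 0"
  shows "is_arg_min f (\<lambda>x. x \<in> {x \<in> K. g x \<in> nonpos_orthant + span {g xbar} \<and> h x = 0}) xbar
     \<longleftrightarrow> e_quasiconvex_at K
           (({..0} - {0}) \<times> (nonpos_orthant + span {g xbar}) \<times> {0})
           (\<lambda>x y. (0, (\<chi> i. e i x y), 0))
           (\<lambda>x. (f x, g x, h x))
           xbar"
proof -
  define P where "P = nonpos_orthant + span {g xbar}"
  define \<phi> where "\<phi> = (\<lambda>x. (f x, g x, h x))"
  have xbar: "xbar \<in> K" "\<And>i. g xbar $ i \<le> 0" "h xbar = 0"
    using assms(4) by (auto simp: vec_eq_iff)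
  have zero: "0 \<in> P"
    unfolding P_def using set_plus_intro[of 0 nonpos_orthant 0 "span {g xbar}"]
    by (simp add: nonpos_orthant_def span_zero)
  \<comment> \<open>Quasiconvexity speaks of increments of \<open>g\<close>, feasibility of its
    values; for membership in \<open>P\<close> the two agree.\<close>
  have shift: "g x - g xbar \<in> P \<longleftrightarrow> g x \<in> P" for x
    unfolding P_def using add_mem_plus_span_singleton_iff[of "g x - g xbar" "g xbar"] by simp
  have gxbar: "g xbar \<in> P"
    using zero shift[of xbar] by simp
  obtain u v where u: "\<And>i. 0 \<le> u $ i" "u \<bullet> g xbar = 0"
    and uv: "\<And>x. x \<in> K \<Longrightarrow>
      blinfun_apply
        (gateaux_deriv K f xbar
         + (\<Sum>i\<in>UNIV. u $ i *\<^sub>R gateaux_deriv K (\<lambda>x. g x $ i) xbar)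
         + (\<Sum>j\<in>UNIV. v $ j *\<^sub>R gateaux_deriv K (\<lambda>x. h x $ j) xbar)) (x - xbar)
      \<ge> u \<bullet> (\<chi> i. e i x xbar)"
    using assms(11) by (auto simp: inner_vec_def)
  \<comment> \<open>The multiplier inequality in terms of directional derivatives, with the error
    moved to the left so that it sits next to \<open>dg\<close> as in the conclusion of
    quasiconvexity.\<close>
  have mult: "df + u \<bullet> (dg - (\<chi> i. e i x xbar)) + v \<bullet> dh \<ge> 0"
    if "x \<in> K" "has_dir_deriv K f xbar (x - xbar) df"
      "has_dir_deriv K g xbar (x - xbar) dg" "has_dir_deriv K h xbar (x - xbar) dh"
    for x df dg dh
  proof -
    have "blinfun_apply (gateaux_deriv K f xbar) (x - xbar) = df"
      "\<And>i. blinfun_apply (gateaux_deriv K (\<lambda>x. g x $ i) xbar) (x - xbar) = dg $ i"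
      "\<And>j. blinfun_apply (gateaux_deriv K (\<lambda>x. h x $ j) xbar) (x - xbar) = dh $ j"
      \<comment> \<open>Both sides of each equation are directional derivatives of the same scalar
        function in the same direction.\<close>
      using that xbar(1) assms(8-10)
      by (blast intro: has_dir_deriv_unique has_dir_deriv_nth
          gateaux_differentiable_on_imp_has_dir_deriv)+
    then show ?thesis
      using uv[OF that(1)]
      by (simp add: blinfun.add_left blinfun.sum_left blinfun.scaleR_left
          inner_vec_def right_diff_distrib sum_subtractf)
  qed
  have deriv: "\<exists>df dg dh. has_dir_deriv K f xbar (x - xbar) df \<and>
      has_dir_deriv K g xbar (x - xbar) dg \<and> has_dir_deriv K h xbar (x - xbar) dh \<and>
      has_dir_deriv K \<phi> xbar (x - xbar) (df, dg, dh)" if "x \<in> K" for x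
  proof -
    from assms(5-7)[OF that] obtain df dg dh where "has_dir_deriv K f xbar (x - xbar) df"
        "has_dir_deriv K g xbar (x - xbar) dg" "has_dir_deriv K h xbar (x - xbar) dh"
      by blast
    then show ?thesis
      unfolding \<phi>_def by (intro exI conjI has_dir_deriv_Pair)
  qed
  \<comment> \<open>Along a standard basis vector the error is either some \<open>e i\<close> or
    zero.\<close>
  have bif: "\<forall>b\<in>Basis. error_bifunction
      (\<lambda>x y. (0::real, (\<chi> i. e i x y) :: real ^ 'm, 0 :: real ^ 'k) \<bullet> b)"
    using assms(3)
    by (auto simp: Basis_prod_def Basis_vec_def inner_axis error_bifunction_zero)
  have quasi: "e_quasiconvex_at K (({..0} - {0}) \<times> P \<times> {0}) (\<lambda>x y. (0, (\<chi> i. e i x y), 0)) \<phi> xbar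
    \<longleftrightarrow> (\<forall>x\<in>K. \<phi> x - \<phi> xbar \<in> ({..0} - {0}) \<times> P \<times> {0} \<longrightarrow>
          dir_deriv K \<phi> xbar (x - xbar) - (0, (\<chi> i. e i x xbar), 0) \<in> ({..0} - {0}) \<times> P \<times> {0})"
  proof -
    \<comment> \<open>Any negative first entry gives a witness that the cone is nonempty.\<close>
    have "(- 1 :: real, 0, 0) \<in> ({..0} - {0}) \<times> P \<times> {0 :: real ^ 'k}"
      using zero by simp
    then have "({..0::real} - {0}) \<times> P \<times> {0 :: real ^ 'k} \<noteq> {}"
      by blast
    moreover have "\<forall>x\<in>K. \<exists>d. has_dir_deriv K \<phi> xbar (x - xbar) d"
      using deriv by blast
    ultimately show ?thesis
      using xbar(1) bif unfolding e_quasiconvex_at_def by simp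
  qed
  have prem: "\<phi> x - \<phi> xbar \<in> ({..0} - {0}) \<times> P \<times> {0} \<longleftrightarrow> f x < f xbar \<and> g x \<in> P \<and> h x = 0" for x
    using shift xbar(3) by (auto simp: \<phi>_def)
  \<comment> \<open>The multipliers exclude this membership at every point of \<open>K\<close>,
    whether or not the premise of quasiconvexity holds there.\<close>
  have concl: "dir_deriv K \<phi> xbar (x - xbar) - (0, (\<chi> i. e i x xbar), 0)
      \<notin> ({..0} - {0}) \<times> P \<times> {0}" if "x \<in> K" for x
  proof
    assume mem: "dir_deriv K \<phi> xbar (x - xbar) - (0, (\<chi> i. e i x xbar), 0)
      \<in> ({..0} - {0}) \<times> P \<times> {0}"
    obtain df dg dh where d: "has_dir_deriv K f xbar (x - xbar) df"
        "has_dir_deriv K g xbar (x - xbar) dg" "has_dir_deriv K h xbar (x - xbar) dh"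
      and "has_dir_deriv K \<phi> xbar (x - xbar) (df, dg, dh)"
      using deriv[OF \<open>x \<in> K\<close>] by blast
    \<comment> \<open>The factor \<open>{0}\<close> forces \<open>dh = 0\<close>, which removes the
      term with \<open>v\<close>, whose sign is unrestricted.\<close>
    with mem have neg: "df < 0" "dg - (\<chi> i. e i x xbar) \<in> P" "dh = 0"
      by (auto simp: dir_deriv_eqI)
    then have "u \<bullet> (dg - (\<chi> i. e i x xbar)) \<le> 0"
      using inner_nonpos_orthant_plus_span_le_zero[OF u] unfolding P_def by blast
    with neg mult[OF \<open>x \<in> K\<close> d] show False
      by simp
  qed
  \<comment> \<open>A minimizer must itself be feasible; \<open>gxbar\<close> and
    \<open>h xbar = 0\<close> provide this.\<close>
  have "is_arg_min f (\<lambda>x. x \<in> {x \<in> K. g x \<in> P \<and> h x = 0}) xbar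
    \<longleftrightarrow> (\<forall>x\<in>K. \<not> (f x < f xbar \<and> g x \<in> P \<and> h x = 0))"
    using xbar gxbar by (auto simp: is_arg_min_def)
  also have "\<dots> \<longleftrightarrow> e_quasiconvex_at K (({..0} - {0}) \<times> P \<times> {0})
      (\<lambda>x y. (0, (\<chi> i. e i x y), 0)) \<phi> xbar"
    \<comment> \<open>Since its conclusion never holds on \<open>K\<close>, the quasiconvexity
      implication at \<open>x\<close> amounts to the negation of its premise, that is, to
      \<open>x\<close> not being a feasible point with a smaller value of \<open>f\<close>.\<close>
    unfolding quasi prem using concl by blast
  finally show ?thesis
    unfolding P_def \<phi>_def .
qed

end
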